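(* For every integer $d\ge2$ the set $\mathcal{F}=\{f\in\mathrm{Homeo}([0,1]^d):\mathcal{H}^d(\operatorname{graph}(f))=\infty\}$ is compact catcher in $\mathrm{Homeo}([0,1]^d)$; in particular, it is not Haar null.
   Context: $\mathrm{Homeo}([0,1]^d)$ is the group (under composition) of homeomorphisms of $[0,1]^d$ with the topology of the maximum metric $\max_x|f(x)-g(x)|$; it is a Polish group. A subset $A$ of a Polish group $G$ is compact catcher if for every compact $K\subseteq G$ there exist $g,h\in G$ with $gKh\subseteq A$. A subset $X\subseteq G$ is Haar null if there exist a Borel probability measure $\mu$ on $G$ and a Borel set $B\supseteq X$ such that $\mu(gBh)=0$ for all $g,h\in G$. $\operatorname{graph}(f)=\{(x,f(x)):x\in[0,1]^d\}\subseteq\mathbb{R}^{2d}$. For $A\subseteq\mathbb{R}^m$ and $s\ge0$, $\mathcal{H}^s(A)=\lim_{\delta\downarrow0}\mathcal{H}^s_\delta(A)$ with $\mathcal{H}^s_\delta(A)=\inf\{\sum_{i=1}^\infty(\operatorname{diam}A_i)^s: A\subseteq\bigcup_i A_i,\ \operatorname{diam}A_i\le\delta \text{ for all } i\}$. *)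

theory Defs
  imports "HOL-Analysis.Analysis" "HOL-Probability.Probability_Measure" "HOL-Algebra.Bij"
begin

section \<open>Compact catcher and Haar null sets\<close>

text \<open>
  A topological group is given by a group \<open>G\<close> together with a topology \<open>T\<close> whose
  underlying set is \<open>carrier G\<close>.
\<close>

definition two_sided_translate :: "('a, 'b) monoid_scheme \<Rightarrow> 'a \<Rightarrow> 'a set \<Rightarrow> 'a \<Rightarrow> 'a set" where
  "two_sided_translate G g A h = (\<lambda>a. g \<otimes>\<^bsub>G\<^esub> a \<otimes>\<^bsub>G\<^esub> h) ` A"

definition compact_catcher :: "('a, 'b) monoid_scheme \<Rightarrow> 'a topology \<Rightarrow> 'a set \<Rightarrow> bool" where
  "compact_catcher G T A \<longleftrightarrow>
     A \<subseteq> carrier G \<and>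
     (\<forall>K. compactin T K \<longrightarrow>
        (\<exists>g\<in>carrier G. \<exists>h\<in>carrier G. two_sided_translate G g K h \<subseteq> A))"

definition borel_sets_of :: "'a topology \<Rightarrow> 'a set set" where
  "borel_sets_of T = sigma_sets (topspace T) {U. openin T U}"

definition haar_null :: "('a, 'b) monoid_scheme \<Rightarrow> 'a topology \<Rightarrow> 'a set \<Rightarrow> bool" where
  "haar_null G T X \<longleftrightarrow>
     X \<subseteq> carrier G \<and>
     (\<exists>\<mu> B. prob_space \<mu> \<and> sets \<mu> = borel_sets_of T \<and>
        B \<in> borel_sets_of T \<and> X \<subseteq> B \<and>
        (\<forall>g\<in>carrier G. \<forall>h\<in>carrier G. emeasure \<mu> (two_sided_translate G g B h) = 0))"


section \<open>The homeomorphism group of a set\<close>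

text \<open>
  As for \<^const>\<open>Bij\<close>, self-maps of \<open>S\<close> are represented by functions that are
  \<^const>\<open>undefined\<close> outside \<open>S\<close>, so that equality of elements is equality on \<open>S\<close>.
\<close>

definition Homeo :: "'a::topological_space set \<Rightarrow> ('a \<Rightarrow> 'a) set" where
  "Homeo S = {f \<in> extensional S. \<exists>g. homeomorphism S S f g}"

definition HomeoGroup :: "'a::topological_space set \<Rightarrow> ('a \<Rightarrow> 'a) monoid" where
  "HomeoGroup S = (BijGroup S)\<lparr>carrier := Homeo S\<rparr>"

text \<open>
  The library metric on \<^const>\<open>cfunspace\<close> is the supremum metric; for compact \<open>S\<close>
  the supremum is attained.
\<close>

definition Homeo_topology :: "'a::metric_space set \<Rightarrow> ('a \<Rightarrow> 'a) topology" where
  "Homeo_topology S =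
     mtopology_of (submetric (cfunspace (top_of_set S) euclidean_metric) (Homeo S))"

lemma carrier_HomeoGroup [simp]: "carrier (HomeoGroup S) = Homeo S"
  by (simp add: HomeoGroup_def)

lemma Homeo_subset_Bij: "Homeo S \<subseteq> Bij S"
proof
  fix f assume "f \<in> Homeo S"
  then obtain g where f: "f \<in> extensional S" and "homeomorphism S S f g"
    by (auto simp: Homeo_def)
  then have "bij_betw f S S"
    by (metis bij_betw_def homeomorphism_def inj_on_inverseI)
  with f show "f \<in> Bij S" by (simp add: Bij_def)
qed

lemma mult_HomeoGroup:
  assumes "f \<in> Homeo S" "g \<in> Homeo S"
  shows "f \<otimes>\<^bsub>HomeoGroup S\<^esub> g = compose S f g"
  using assms Homeo_subset_Bij[of S] by (auto simp: HomeoGroup_def BijGroup_def)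

lemma one_HomeoGroup: "\<one>\<^bsub>HomeoGroup S\<^esub> = (\<lambda>x\<in>S. x)"
  by (simp add: HomeoGroup_def BijGroup_def)

lemma compose_Homeo:
  assumes "f \<in> Homeo S" "g \<in> Homeo S"
  shows "compose S f g \<in> Homeo S"
proof -
  obtain f' g' where "homeomorphism S S f f'" "homeomorphism S S g g'"
    using assms by (auto simp: Homeo_def)
  then have "homeomorphism S S (f \<circ> g) (g' \<circ> f')"
    by (blast intro: homeomorphism_compose)
  then have "homeomorphism S S (compose S f g) (g' \<circ> f')"
    by (rule homeomorphism_cong) (auto simp: compose_def)
  then show ?thesis by (auto simp: Homeo_def)
qed

lemma group_HomeoGroup: "group (HomeoGroup S)"
proof (rule groupI)
  show "\<one>\<^bsub>HomeoGroup S\<^esub> \<in> carrier (HomeoGroup S)"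
  proof -
    have "homeomorphism S S (\<lambda>x\<in>S. x) (\<lambda>x. x)"
      by (rule homeomorphism_cong[OF homeomorphism_ident]) auto
    then show ?thesis by (auto simp: Homeo_def one_HomeoGroup)
  qed
next
  fix f assume "f \<in> carrier (HomeoGroup S)"
  then have fH: "f \<in> Homeo S" by simp
  then obtain g where g: "homeomorphism S S f g"
    by (auto simp: Homeo_def)
  then have "homeomorphism S S (restrict g S) f"
    by (intro homeomorphism_cong[OF homeomorphism_symD[OF g]]) auto
  then have gH: "restrict g S \<in> Homeo S"
    by (auto simp: Homeo_def)
  moreover have "compose S (restrict g S) f = (\<lambda>x\<in>S. x)"
    using g by (auto simp: compose_def restrict_def homeomorphism_def fun_eq_iff)
  ultimately show "\<exists>y\<in>carrier (HomeoGroup S). y \<otimes>\<^bsub>HomeoGroup S\<^esub> f = \<one>\<^bsub>HomeoGroup S\<^esub>"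
    using fH by (metis carrier_HomeoGroup mult_HomeoGroup one_HomeoGroup)
next
  fix f assume f: "f \<in> carrier (HomeoGroup S)"
  then have "f \<in> Bij S" using Homeo_subset_Bij by auto
  then show "\<one>\<^bsub>HomeoGroup S\<^esub> \<otimes>\<^bsub>HomeoGroup S\<^esub> f = f"
    using group.is_monoid[OF group_BijGroup[of S], THEN monoid.l_one, of f]
    by (simp add: HomeoGroup_def BijGroup_def)
next
  fix f g h
  assume *: "f \<in> carrier (HomeoGroup S)" "g \<in> carrier (HomeoGroup S)" "h \<in> carrier (HomeoGroup S)"
  then have "h \<in> S \<rightarrow> S" using Homeo_subset_Bij[of S] Bij_imp_funcset by auto
  then show "f \<otimes>\<^bsub>HomeoGroup S\<^esub> g \<otimes>\<^bsub>HomeoGroup S\<^esub> h = f \<otimes>\<^bsub>HomeoGroup S\<^esub> (g \<otimes>\<^bsub>HomeoGroup S\<^esub> h)"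
    using * by (simp add: mult_HomeoGroup compose_Homeo compose_assoc)
qed (simp add: mult_HomeoGroup compose_Homeo)

lemma Homeo_subset_cfunspace:
  assumes "compact S"
  shows "Homeo S \<subseteq> mspace (cfunspace (top_of_set S) euclidean_metric)"
proof
  fix f assume "f \<in> Homeo S"
  then obtain g where f: "f \<in> extensional S" and "homeomorphism S S f g"
    by (auto simp: Homeo_def)
  then have "continuous_on S f" "f ` S = S" by (auto simp: homeomorphism_def)
  moreover have "bounded S" using assms by (rule compact_imp_bounded)
  ultimately show "f \<in> mspace (cfunspace (top_of_set S) euclidean_metric)"
    using f by simp
qed

lemma topspace_Homeo_topology:
  assumes "compact S"
  shows "topspace (Homeo_topology S) = Homeo S"
  using Homeo_subset_cfunspace[OF assms] by (auto simp: Homeo_topology_def)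

lemma mdist_Homeo:
  assumes "compact S" "S \<noteq> {}" "f \<in> Homeo S" "g \<in> Homeo S"
  shows "mdist (submetric (cfunspace (top_of_set S) euclidean_metric) (Homeo S)) f g
         = (SUP x\<in>S. dist (f x) (g x))"
proof -
  have "f \<in> Met_TC.fspace S" "g \<in> Met_TC.fspace S"
    using assms(3,4) Homeo_subset_cfunspace[OF assms(1)] by (auto simp: Met_TC.fspace_def)
  then show ?thesis
    using assms(2) by (simp add: mdist_cfunspace_eq_mdist_funspace Met_TC.fdist_def)
qed


section \<open>Hausdorff measure\<close>

text \<open>
  The \<open>s\<close>-th power of the diameter, with the usual conventions that the empty set
  contributes \<open>0\<close> and that \<open>0\<^sup>0 = 1\<close> for nonempty sets (whereas \<open>0 powr 0 = 0\<close>).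
\<close>

definition diam_pow :: "real \<Rightarrow> 'a::metric_space set \<Rightarrow> ennreal" where
  "diam_pow s U = (if U = {} then 0 else if s = 0 then 1 else ennreal (diameter U powr s))"

text \<open>
  Boundedness is required explicitly because the real-valued \<^const>\<open>diameter\<close> is
  meaningless for unbounded sets.
\<close>

definition hausdorff_premeasure :: "real \<Rightarrow> real \<Rightarrow> 'a::metric_space set \<Rightarrow> ennreal" where
  "hausdorff_premeasure s \<delta> A =
     Inf {(\<Sum>i. diam_pow s (U i)) | U :: nat \<Rightarrow> 'a set.
            A \<subseteq> (\<Union>i. U i) \<and> (\<forall>i. bounded (U i) \<and> diameter (U i) \<le> \<delta>)}"

definition hausdorff_measure :: "real \<Rightarrow> 'a::metric_space set \<Rightarrow> ennreal" where
  "hausdorff_measure s A = Lim (at_right 0) (\<lambda>\<delta>. hausdorff_premeasure s \<delta> A)"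

lemma hausdorff_premeasure_antimono:
  assumes "\<delta> \<le> \<delta>'"
  shows "hausdorff_premeasure s \<delta>' A \<le> hausdorff_premeasure s \<delta> A"
  unfolding hausdorff_premeasure_def
  by (rule Inf_superset_mono) (use assms order_trans in blast)

lemma tendsto_hausdorff_premeasure_SUP:
  "((\<lambda>\<delta>. hausdorff_premeasure s \<delta> A) \<longlongrightarrow> (SUP \<delta>\<in>{0<..}. hausdorff_premeasure s \<delta> A)) (at_right 0)"
proof (rule increasing_tendsto)
  show "\<forall>\<^sub>F \<delta> in at_right 0. hausdorff_premeasure s \<delta> A \<le> (SUP \<delta>\<in>{0<..}. hausdorff_premeasure s \<delta> A)"
    by (rule eventually_at_right_less[THEN eventually_mono]) (auto intro: SUP_upper)
next
  fix x assume "x < (SUP \<delta>\<in>{0<..}. hausdorff_premeasure s \<delta> A)"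
  then obtain \<delta>0 where \<delta>0: "\<delta>0 > 0" "x < hausdorff_premeasure s \<delta>0 A"
    by (auto simp: less_SUP_iff)
  show "\<forall>\<^sub>F \<delta> in at_right 0. x < hausdorff_premeasure s \<delta> A"
    unfolding eventually_at_right_field
    using \<delta>0 hausdorff_premeasure_antimono less_le_trans less_imp_le by metis
qed

lemma hausdorff_measure_eq_SUP:
  "hausdorff_measure s A = (SUP \<delta>\<in>{0<..}. hausdorff_premeasure s \<delta> A)"
  unfolding hausdorff_measure_def
  by (rule tendsto_Lim[OF _ tendsto_hausdorff_premeasure_SUP]) simp


section \<open>Graphs and the unit cube\<close>

text \<open>
  The product type carries the Euclidean product metric, so for \<open>S\<close> in \<open>\<real>\<^sup>d\<close> the graph
  lives in an isometric copy of \<open>\<real>\<^sup>2\<^sup>d\<close>.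
\<close>

definition graph_on :: "'a set \<Rightarrow> ('a \<Rightarrow> 'b) \<Rightarrow> ('a \<times> 'b) set" where
  "graph_on S f = {(x, f x) | x. x \<in> S}"

abbreviation unit_cube :: "(real ^ 'n) set" where
  "unit_cube \<equiv> {x. \<forall>i. 0 \<le> x $ i \<and> x $ i \<le> 1}"

end

theory Submission
  imports Defs
begin

text \<open>
  Fix two coordinates \<open>i \<noteq> j\<close>. A compact set \<open>K\<close> of homeomorphisms and the set of their inverses are
  uniformly equicontinuous. Hence for \<open>c \<noteq> c'\<close> some coordinate of every \<open>k \<in> K\<close> differs by at least a
  fixed \<open>\<tau> > 0\<close> between two slabs of width \<open>\<tau>\<close> in the hyperplanes \<open>y\<^sub>i = c\<close> and \<open>y\<^sub>i = c'\<close>. Let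
  \<open>h\<close> raise \<open>x\<^sub>i\<close> to the power \<open>1 + W (x\<^sub>j)\<close> and keep the other coordinates, where \<open>W \<ge> 0\<close> oscillates with
  small amplitude but huge frequency. On each of the \<open>M\<close> oscillations, \<open>h\<close> carries segments in
  direction \<open>j\<close> from one slab to the other, so a coordinate of \<open>k \<circ> h\<close> sweeps an interval of length
  \<open>\<tau>\<close> along them. Replacing \<open>x\<^sub>j\<close> by that coordinate projects \<open>M\<close> separated pieces of the graph of \<open>k \<circ> h\<close>
  onto one cube of side \<open>\<tau>\<close>. Since \<open>M\<close> is chosen after \<open>\<tau>\<close>, this makes the \<open>d\<close>-dimensional measure of
  the graph arbitrarily large, and infinite once all scales are put into one \<open>W\<close>.

  Only the equicontinuity of \<open>K\<close> matters, and every Borel probability measure charges some Borel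
  equicontinuous set; a translate of it inside \<open>F\<close> contradicts Haar nullness.
\<close>

section \<open>A lower bound for Hausdorff measure\<close>

text \<open>The image lies in the cube of half-side \<open>diameter U\<close> around one of its
  points; the doubled side accounts for the factor 2 ^ d. A cube is used since the image itself need
  not be measurable.\<close>

lemma nonexpansive_image_cover:
  fixes \<pi> :: "'a::metric_space \<Rightarrow> 'b::euclidean_space"
  assumes nonexp: "\<And>x y. dist (\<pi> x) (\<pi> y) \<le> dist x y" and "bounded U"
  obtains Q where "Q \<in> sets lborel" "\<pi> ` U \<subseteq> Q"
    "emeasure lborel Q \<le> 2 ^ DIM('b) * diam_pow (real DIM('b)) U"
proof (cases "U = {}")
  case True
  then show ?thesis by (intro that[of "{}"]) auto
next
  case False
  then obtain x where x: "x \<in> U" by auto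
  define D where "D = diameter U"
  have D0: "0 \<le> D" by (simp add: D_def diameter_ge_0 assms(2))
  let ?Q = "cbox (\<pi> x - D *\<^sub>R One) (\<pi> x + D *\<^sub>R One)"
  have sub: "\<pi> ` U \<subseteq> ?Q"
  proof
    fix z assume "z \<in> \<pi> ` U"
    then obtain y where y: "y \<in> U" "z = \<pi> y" by auto
    have "dist z (\<pi> x) \<le> D"
      using nonexp[of y x] diameter_bounded_bound[OF assms(2) y(1) x] y by (simp add: D_def)
    then have "\<bar>(z - \<pi> x) \<bullet> b\<bar> \<le> D" if "b \<in> Basis" for b
      using Basis_le_norm[OF that, of "z - \<pi> x"] by (simp add: dist_norm)
    then show "z \<in> ?Q"
      by (fastforce simp: mem_box inner_diff_left inner_add_left abs_le_iff)
  qed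
  have "emeasure lborel ?Q = ennreal (\<Prod>b\<in>(Basis::'b set). 2 * D)"
    using D0 by (subst emeasure_lborel_cbox) (auto simp: inner_diff_left inner_add_left)
  also have "\<dots> = ennreal ((2 * D) ^ DIM('b))" by simp
  also have "\<dots> = 2 ^ DIM('b) * ennreal (D ^ DIM('b))"
    using D0 by (simp add: power_mult_distrib ennreal_mult ennreal_power[symmetric])
  \<comment> \<open>For \<open>D = 0\<close> both sides vanish because the dimension is
    positive.\<close>
  also have "D ^ DIM('b) = D powr real DIM('b)"
    using D0 by (cases "D = 0") (auto simp: powr_realpow zero_power)
  finally have "emeasure lborel ?Q = 2 ^ DIM('b) * diam_pow (real DIM('b)) U"
    using False by (simp add: diam_pow_def D_def)
  with sub show ?thesis by (intro that[of ?Q]) auto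
qed

text \<open>
  A covering set of diameter below \<open>g\<close> meets at most one of the pieces \<open>P i\<close>, so the bounds that \<open>\<pi>\<close>
  yields for the individual pieces add up even though their images overlap.
\<close>

lemma hausdorff_measure_ge_multiplicity:
  fixes \<pi> :: "'a::metric_space \<Rightarrow> 'b::euclidean_space"
  assumes nonexp: "\<And>x y. dist (\<pi> x) (\<pi> y) \<le> dist x y"
    and "finite I" and "g > 0"
    and sep: "\<And>i j x y. i \<in> I \<Longrightarrow> j \<in> I \<Longrightarrow> i \<noteq> j \<Longrightarrow> x \<in> P i \<Longrightarrow> y \<in> P j \<Longrightarrow> g \<le> dist x y"
    and sub: "\<And>i. i \<in> I \<Longrightarrow> P i \<subseteq> A"
    and E: "\<And>i. i \<in> I \<Longrightarrow> E \<subseteq> \<pi> ` P i"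
  shows "of_nat (card I) * emeasure lborel E \<le> 2 ^ DIM('b) * hausdorff_measure (real DIM('b)) A"
proof -
  let ?c = "2 ^ DIM('b) :: ennreal"
  let ?d = "real DIM('b)"
  have "of_nat (card I) * emeasure lborel E / ?c \<le> hausdorff_premeasure ?d (g/2) A"
    unfolding hausdorff_premeasure_def
  proof (rule Inf_greatest)
    fix v assume "v \<in> {(\<Sum>i. diam_pow ?d (U i)) | U :: nat \<Rightarrow> 'a set.
      A \<subseteq> (\<Union>i. U i) \<and> (\<forall>i. bounded (U i) \<and> diameter (U i) \<le> g/2)}"
    then obtain U :: "nat \<Rightarrow> 'a set" where v: "v = (\<Sum>i. diam_pow ?d (U i))"
      and cov: "A \<subseteq> (\<Union>i. U i)" and U: "\<forall>i. bounded (U i) \<and> diameter (U i) \<le> g/2"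
      by blast
    have "\<exists>Q. Q \<in> sets lborel \<and> \<pi> ` U l \<subseteq> Q \<and> emeasure lborel Q \<le> ?c * diam_pow ?d (U l)" for l
      using nonexpansive_image_cover[OF nonexp, of "U l"] U by metis
    then obtain Q where Q: "\<And>l. Q l \<in> sets lborel" "\<And>l. \<pi> ` U l \<subseteq> Q l"
      "\<And>l. emeasure lborel (Q l) \<le> ?c * diam_pow ?d (U l)" by metis
    \<comment> \<open>\<open>Q l\<close> is charged to piece i only if \<open>U l\<close> meets
      \<open>P i\<close>. For fixed l this happens for at most one i, so summing over
      \<open>I\<close> counts \<open>E\<close> with multiplicity but each \<open>Q l\<close> at most
      once.\<close>
    define R where "R i l = (if U l \<inter> P i = {} then {} else Q l)" for i l
    have R: "R i l \<in> sets lborel" for i l using Q(1) by (auto simp: R_def)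
    have "emeasure lborel E \<le> (\<Sum>l. emeasure lborel (R i l))" if i: "i \<in> I" for i
    proof -
      have "E \<subseteq> (\<Union>l. R i l)"
      proof
        fix z assume "z \<in> E"
        then obtain x where x: "x \<in> P i" "z = \<pi> x" using E[OF i] by auto
        then obtain l where "x \<in> U l" using cov sub[OF i] by auto
        then show "z \<in> (\<Union>l. R i l)" using x Q(2)[of l] by (auto simp: R_def intro!: exI[of _ l])
      qed
      then have "emeasure lborel E \<le> emeasure lborel (\<Union>l. R i l)"
        by (rule emeasure_mono) (use R in auto)
      also have "\<dots> \<le> (\<Sum>l. emeasure lborel (R i l))"
        by (rule emeasure_subadditive_countably) (use R in auto)
      finally show ?thesis .
    qed
    then have "(\<Sum>i\<in>I. emeasure lborel E) \<le> (\<Sum>i\<in>I. \<Sum>l. emeasure lborel (R i l))"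
      by (rule sum_mono)
    also have "\<dots> = (\<Sum>l. \<Sum>i\<in>I. emeasure lborel (R i l))"
      by (rule suminf_sum[symmetric]) simp
    also have "\<dots> \<le> (\<Sum>l. ?c * diam_pow ?d (U l))"
    proof (rule suminf_le)
      fix l
      show "(\<Sum>i\<in>I. emeasure lborel (R i l)) \<le> ?c * diam_pow ?d (U l)"
      proof (cases "\<exists>i\<in>I. U l \<inter> P i \<noteq> {}")
        case True
        then obtain i x where i: "i \<in> I" "x \<in> U l" "x \<in> P i" by auto
        have "R j l = {}" if j: "j \<in> I - {i}" for j
        proof (rule ccontr)
          assume "R j l \<noteq> {}"
          then obtain y where y: "y \<in> U l" "y \<in> P j" by (auto simp: R_def split: if_splits)
          have "dist x y \<le> g/2"
            using diameter_bounded_bound[of "U l" x y] U i y by (meson order_trans)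
          then show False using sep[of i j x y] i y j \<open>g > 0\<close> by auto
        qed
        then have "(\<Sum>i\<in>I. emeasure lborel (R i l)) = emeasure lborel (R i l)"
          using \<open>finite I\<close> i by (subst sum.remove[of I i]) auto
        also have "\<dots> \<le> emeasure lborel (Q l)" by (auto simp: R_def)
        finally show ?thesis using Q(3) order_trans by blast
      next
        case False
        then show ?thesis by (simp add: R_def)
      qed
    qed auto
    also have "\<dots> = ?c * (\<Sum>l. diam_pow ?d (U l))" by (rule ennreal_suminf_cmult)
    finally show "of_nat (card I) * emeasure lborel E / ?c \<le> v"
      unfolding v by (intro divide_le_posI_ennreal) (simp_all add: mult.commute zero_less_iff_neq_zero)
  qed
  also have "\<dots> \<le> hausdorff_measure ?d A"
    unfolding hausdorff_measure_eq_SUP using \<open>g > 0\<close> by (intro SUP_upper) auto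
  finally have le: "of_nat (card I) * emeasure lborel E / ?c \<le> hausdorff_measure ?d A" .
  have "of_nat (card I) * emeasure lborel E = ?c * (of_nat (card I) * emeasure lborel E / ?c)"
    unfolding ennreal_times_divide mult.commute[of ?c]
    by (rule mult_divide_eq_ennreal[symmetric]) (simp_all add: power_eq_top_ennreal)
  also have "\<dots> \<le> ?c * hausdorff_measure ?d A" using le by (rule mult_left_mono) simp
  finally show ?thesis .
qed

section \<open>Equicontinuous sets of homeomorphisms\<close>

text \<open>
  The lower bound \<open>\<delta> \<le> dist (f x) (f y)\<close> is a modulus of continuity for the inverse of \<open>f\<close>, stated
  without mentioning it.
\<close>

definition modulus_set :: "'a::metric_space set \<Rightarrow> real \<Rightarrow> real \<Rightarrow> ('a \<Rightarrow> 'a) set" where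
  "modulus_set S \<epsilon> \<delta> = {f \<in> Homeo S. \<forall>x\<in>S. \<forall>y\<in>S.
     (dist x y \<le> \<delta> \<longrightarrow> dist (f x) (f y) \<le> \<epsilon>) \<and> (\<epsilon> \<le> dist x y \<longrightarrow> \<delta> \<le> dist (f x) (f y))}"

definition biequicontinuous :: "'a::metric_space set \<Rightarrow> ('a \<Rightarrow> 'a) set \<Rightarrow> bool" where
  "biequicontinuous S K \<longleftrightarrow> (\<forall>\<epsilon>>0. \<exists>\<delta>>0. K \<subseteq> modulus_set S \<epsilon> \<delta>)"

lemma modulus_set_antimono: "\<delta>' \<le> \<delta> \<Longrightarrow> modulus_set S \<epsilon> \<delta> \<subseteq> modulus_set S \<epsilon> \<delta>'"
  unfolding modulus_set_def by fastforce

lemma modulus_set_mono: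
  assumes "\<epsilon> \<le> \<epsilon>'" shows "modulus_set S \<epsilon> \<delta> \<subseteq> modulus_set S \<epsilon>' \<delta>"
  using order_trans assms unfolding modulus_set_def by blast

section \<open>Compact sets are equicontinuous together with their inverses\<close>

lemma Homeo_topology_nbhd:
  assumes "compact S" "f \<in> Homeo S" "0 < r"
  obtains U where "openin (Homeo_topology S) U" "f \<in> U" "U \<subseteq> Homeo S"
    "\<And>g x. g \<in> U \<Longrightarrow> x \<in> S \<Longrightarrow> dist (f x) (g x) \<le> r"
proof -
  let ?m = "submetric (cfunspace (top_of_set S) euclidean_metric) (Homeo S)"
  let ?U = "mball_of ?m f r"
  have sp: "mspace ?m = Homeo S" using Homeo_subset_cfunspace[OF assms(1)] by auto
  have "openin (Homeo_topology S) ?U"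
    unfolding Homeo_topology_def mtopology_of_def mball_of_def
    by (rule Metric_space.openin_mball[OF Metric_space_mspace_mdist])
  moreover have "f \<in> ?U"
    unfolding mball_of_def Metric_space.centre_in_mball_iff[OF Metric_space_mspace_mdist]
    unfolding sp using assms by blast
  moreover have "?U \<subseteq> mspace ?m"
    unfolding mball_of_def by (rule Metric_space.mball_subset_mspace[OF Metric_space_mspace_mdist])
  then have "?U \<subseteq> Homeo S" unfolding sp .
  moreover have "dist (f x) (g x) \<le> r" if g: "g \<in> ?U" and x: "x \<in> S" for g x
  proof -
    have gH: "g \<in> Homeo S" and d: "mdist ?m f g < r"
      using g unfolding mball_of_def Metric_space.in_mball[OF Metric_space_mspace_mdist]
      unfolding sp by blast+
    have "f ` S = S" "g ` S = S" using assms(2) gH by (auto simp: Homeo_def homeomorphism_def)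
    then have "bdd_above ((\<lambda>x. dist (f x) (g x)) ` S)"
      by (intro bdd_aboveI2[of _ _ "diameter S"])
         (use compact_imp_bounded[OF assms(1)] diameter_bounded_bound in blast)
    then have "dist (f x) (g x) \<le> (SUP x\<in>S. dist (f x) (g x))" by (rule cSUP_upper[OF x])
    also have "\<dots> = mdist ?m f g"
      by (rule mdist_Homeo[OF assms(1) _ assms(2) gH, symmetric]) (use x in blast)
    finally show ?thesis using d by simp
  qed
  ultimately show ?thesis using that by blast
qed

text \<open>Uniform continuity of \<open>f\<close> and its inverse gives \<open>f\<close> moduli
  with room to spare, and a uniform perturbation by r changes distances between values by at most 2
  r.\<close>

lemma in_interior_modulus_set:
  assumes S: "compact S" and f: "f \<in> Homeo S" and "0 < \<epsilon>"
  obtains \<delta> where "0 < \<delta>" "f \<in> Homeo_topology S interior_of modulus_set S \<epsilon> \<delta>"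
proof -
  obtain f' where f': "homeomorphism S S f f'" using f by (auto simp: Homeo_def)
  have "uniformly_continuous_on S f" "uniformly_continuous_on S f'"
    using f' S by (auto simp: homeomorphism_def intro: compact_uniformly_continuous)
  then obtain \<delta>1 \<delta>2 where \<delta>: "0 < \<delta>1" "0 < \<delta>2"
    and 1: "\<And>x y. x \<in> S \<Longrightarrow> y \<in> S \<Longrightarrow> dist x y < \<delta>1 \<Longrightarrow> dist (f x) (f y) < \<epsilon>/3"
    and 2: "\<And>x y. x \<in> S \<Longrightarrow> y \<in> S \<Longrightarrow> dist x y < \<delta>2 \<Longrightarrow> dist (f' x) (f' y) < \<epsilon>"
    unfolding uniformly_continuous_on_def using \<open>0 < \<epsilon>\<close> by (metis dist_commute divide_pos_pos zero_less_numeral)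
  have 3: "\<delta>2 \<le> dist (f x) (f y)" if "x \<in> S" "y \<in> S" "\<epsilon> \<le> dist x y" for x y
    using 2[of "f x" "f y"] f' that by (force simp: homeomorphism_def)
  \<comment> \<open>The thirds give \<epsilon>/3 + 2 r \<le> \<epsilon> for the upper bound and
    \<delta>2 - 2 r \<ge> \<delta>2/3 for the lower one; \<delta>1/2 meets the strict inequality in
    the modulus of \<open>f\<close>.\<close>
  define r where "r = min (\<epsilon>/3) (\<delta>2/3)"
  define \<delta> where "\<delta> = min (\<delta>1/2) (\<delta>2/3)"
  obtain U where U: "openin (Homeo_topology S) U" "f \<in> U" "U \<subseteq> Homeo S"
    and Ur: "\<And>g x. g \<in> U \<Longrightarrow> x \<in> S \<Longrightarrow> dist (f x) (g x) \<le> r"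
    using Homeo_topology_nbhd[OF S f, of r] \<open>0 < \<epsilon>\<close> \<delta> by (auto simp: r_def)
  have "U \<subseteq> modulus_set S \<epsilon> \<delta>"
  proof
    fix g assume g: "g \<in> U"
    have *: "\<bar>dist (f x) (f y) - dist (g x) (g y)\<bar> \<le> 2 * r" if "x \<in> S" "y \<in> S" for x y
      using Ur[OF g that(1)] Ur[OF g that(2)] by metric
    have "dist (g x) (g y) \<le> \<epsilon>" if "x \<in> S" "y \<in> S" "dist x y \<le> \<delta>" for x y
      using *[OF that(1,2)] 1[OF that(1,2)] that(3) \<delta> unfolding r_def \<delta>_def by linarith
    moreover have "\<delta> \<le> dist (g x) (g y)" if "x \<in> S" "y \<in> S" "\<epsilon> \<le> dist x y" for x y
      using *[OF that(1,2)] 3[OF that] \<delta> unfolding r_def \<delta>_def by linarith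
    ultimately show "g \<in> modulus_set S \<epsilon> \<delta>" using g U(3) by (auto simp: modulus_set_def)
  qed
  then have "f \<in> Homeo_topology S interior_of modulus_set S \<epsilon> \<delta>"
    using U(1,2) interior_of_maximal by blast
  moreover have "0 < \<delta>" using \<delta> by (simp add: \<delta>_def)
  ultimately show ?thesis using that by blast
qed

lemma compactin_imp_biequicontinuous:
  assumes S: "compact S" and K: "compactin (Homeo_topology S) K"
  shows "biequicontinuous S K"
  unfolding biequicontinuous_def
proof (intro allI impI)
  fix \<epsilon> :: real assume "0 < \<epsilon>"
  let ?I = "\<lambda>\<delta>. Homeo_topology S interior_of modulus_set S \<epsilon> \<delta>"
  have "K \<subseteq> \<Union> (?I ` {0<..})"
  proof
    fix f assume "f \<in> K"
    then have "f \<in> Homeo S"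
      using compactin_subset_topspace[OF K] topspace_Homeo_topology[OF S] by auto
    then show "f \<in> \<Union> (?I ` {0<..})"
      using in_interior_modulus_set[OF S _ \<open>0 < \<epsilon>\<close>, of f] by auto
  qed
  moreover have "\<And>U. U \<in> ?I ` {0<..} \<Longrightarrow> openin (Homeo_topology S) U" by auto
  ultimately obtain \<F> where \<F>: "finite \<F>" "\<F> \<subseteq> ?I ` {0<..}" "K \<subseteq> \<Union> \<F>"
    using compactinD[OF K, of "?I ` {0<..}"] by metis
  from finite_subset_image[OF \<F>(1,2)]
  obtain D where D: "D \<subseteq> {0<..} \<and> finite D \<and> \<F> = ?I ` D" ..
  \<comment> \<open>The inserted 1 keeps the minimum meaningful when the subcover is empty.\<close>
  define \<delta> where "\<delta> = Min (insert 1 D)"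
  have "0 < \<delta>" using D by (auto simp: \<delta>_def)
  moreover have "K \<subseteq> modulus_set S \<epsilon> \<delta>"
  proof
    fix f assume "f \<in> K"
    then obtain \<delta>' where d: "\<delta>' \<in> D" "f \<in> ?I \<delta>'" using \<F> D by auto
    have "f \<in> modulus_set S \<epsilon> \<delta>'" by (rule subsetD[OF interior_of_subset d(2)])
    moreover have "\<delta> \<le> \<delta>'" using d D by (simp add: \<delta>_def)
    ultimately show "f \<in> modulus_set S \<epsilon> \<delta>" by (rule subsetD[OF modulus_set_antimono, rotated])
  qed
  ultimately show "\<exists>\<delta>>0. K \<subseteq> modulus_set S \<epsilon> \<delta>" by blast
qed

section \<open>Borel probability measures on the group and Haar null sets\<close>

lemma space_eq_topspace_borel:
  assumes "sets \<mu> = borel_sets_of T"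
  shows "space \<mu> = topspace T"
proof -
  have "{U. openin T U} \<subseteq> Pow (topspace T)" using openin_subset by blast
  then show ?thesis
    using assms sets_eq_imp_space_eq[of \<mu> "sigma (topspace T) {U. openin T U}"]
    by (simp add: borel_sets_of_def)
qed

text \<open>
  Continuity of \<open>\<mu>\<close> along increasing open sets is used here in place of the tightness of measures on
  Polish spaces.
\<close>

lemma biequicontinuous_set_of_positive_measure:
  assumes S: "compact S" and \<mu>: "prob_space \<mu>" "sets \<mu> = borel_sets_of (Homeo_topology S)"
  obtains K where "K \<in> sets \<mu>" "K \<subseteq> Homeo S" "biequicontinuous S K" "0 < emeasure \<mu> K"
proof -
  interpret prob_space \<mu> by fact
  let ?T = "Homeo_topology S"
  have sp: "space \<mu> = Homeo S"
    using space_eq_topspace_borel[OF \<mu>(2)] topspace_Homeo_topology[OF S] by simp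
  \<comment> \<open>Passing to interiors makes the sets open, hence Borel, and they still exhaust
    the group as m grows.\<close>
  define V where "V n m = ?T interior_of modulus_set S (1 / Suc n) (1 / Suc m)" for n m
  have VM: "V n m \<in> sets \<mu>" for n m
    unfolding \<mu>(2) borel_sets_of_def V_def by (intro sigma_sets.Basic) simp
  have "\<exists>m. measure \<mu> (space \<mu> - V n m) < (1/2) ^ Suc (Suc n)" for n
  proof -
    have inc: "incseq (V n)"
      unfolding V_def incseq_def
      by (intro allI impI interior_of_mono modulus_set_antimono) (auto simp: frac_le)
    have "(\<Union>m. V n m) = space \<mu>"
    proof
      show "(\<Union>m. V n m) \<subseteq> space \<mu>" using VM sets.sets_into_space by blast
      show "space \<mu> \<subseteq> (\<Union>m. V n m)"
      proof
        fix f assume "f \<in> space \<mu>"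
        then obtain \<delta> where d: "0 < \<delta>" "f \<in> ?T interior_of modulus_set S (1 / Suc n) \<delta>"
          using in_interior_modulus_set[OF S, of f "1 / Suc n"] sp by auto
        obtain m where "1 / Suc m < \<delta>" using d(1) by (meson nat_approx_posE)
        then have "?T interior_of modulus_set S (1 / Suc n) \<delta> \<subseteq> V n m"
          unfolding V_def by (intro interior_of_mono modulus_set_antimono) simp
        then show "f \<in> (\<Union>m. V n m)" using d by auto
      qed
    qed
    then have "(\<lambda>m. measure \<mu> (V n m)) \<longlonglongrightarrow> 1"
      using finite_Lim_measure_incseq[of "V n"] VM inc prob_space by auto
    then have "\<forall>\<^sub>F m in sequentially. 1 - (1/2) ^ Suc (Suc n) < measure \<mu> (V n m)"
      by (rule order_tendstoD) simp
    then obtain m where "1 - (1/2) ^ Suc (Suc n) < measure \<mu> (V n m)"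
      by (auto simp: eventually_sequentially)
    then show ?thesis using prob_compl[OF VM, of n m] by (intro exI[of _ m]) simp
  qed
  then obtain m where m: "\<And>n. measure \<mu> (space \<mu> - V n (m n)) < (1/2) ^ Suc (Suc n)" by metis
  \<comment> \<open>The discarded masses add up to at most 1/4 + 1/8 + ... = 1/2, so at least half
    of the measure stays on \<open>K\<close>.\<close>
  define K where "K = (\<Inter>n. V n (m n))"
  have KM: "K \<in> sets \<mu>" unfolding K_def using VM by auto
  have half: "(\<lambda>n. (1/2::real) ^ Suc (Suc n)) sums (1/2)"
    using sums_mult[OF power_half_series, of "1/2"] by simp
  have summ: "summable (\<lambda>n. measure \<mu> (space \<mu> - V n (m n)))"
    by (rule summable_comparison_test'[OF sums_summable[OF half], of 0])
      (unfold real_norm_def abs_of_nonneg[OF measure_nonneg], rule less_imp_le[OF m])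
  have "space \<mu> - K = (\<Union>n. space \<mu> - V n (m n))" by (auto simp: K_def)
  moreover have "range (\<lambda>n. space \<mu> - V n (m n)) \<subseteq> sets \<mu>" using VM by auto
  ultimately have "measure \<mu> (space \<mu> - K) \<le> (\<Sum>n. measure \<mu> (space \<mu> - V n (m n)))"
    by (simp only: finite_measure_subadditive_countably[OF _ summ])
  also have "\<dots> \<le> (\<Sum>n. (1/2) ^ Suc (Suc n))"
    by (rule suminf_le[OF less_imp_le[OF m] summ sums_summable[OF half]])
  also have "\<dots> = 1/2" using half by (rule sums_unique[symmetric])
  finally have "1/2 \<le> measure \<mu> K" using prob_compl[OF KM] by simp
  then have pos: "0 < emeasure \<mu> K" by (simp add: emeasure_eq_measure)
  have Km: "K \<subseteq> modulus_set S (1 / Suc n) (1 / Suc (m n))" for n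
  proof -
    have "K \<subseteq> V n (m n)" by (auto simp: K_def)
    also have "\<dots> \<subseteq> modulus_set S (1 / Suc n) (1 / Suc (m n))"
      unfolding V_def by (rule interior_of_subset)
    finally show ?thesis .
  qed
  have "biequicontinuous S K"
    unfolding biequicontinuous_def
  proof (intro allI impI)
    fix \<epsilon> :: real assume "0 < \<epsilon>"
    then obtain n where "1 / Suc n < \<epsilon>" by (meson nat_approx_posE)
    then have "K \<subseteq> modulus_set S \<epsilon> (1 / Suc (m n))"
      using Km[of n] modulus_set_mono[of "1 / Suc n" \<epsilon>] by fastforce
    then show "\<exists>\<delta>>0. K \<subseteq> modulus_set S \<epsilon> \<delta>" by (intro exI[of _ "1 / Suc (m n)"]) simp
  qed
  moreover have "K \<subseteq> Homeo S" using Km[of 0] by (auto simp: modulus_set_def)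
  ultimately show ?thesis using that KM pos by blast
qed

lemma continuous_right_translation:
  assumes S: "compact S" and h: "h \<in> Homeo S"
  shows "continuous_map (Homeo_topology S) (Homeo_topology S) (\<lambda>f. compose S f h)"
proof (cases "S = {}")
  case True
  have "Homeo S \<subseteq> {\<lambda>x. undefined}" using True by (auto simp: Homeo_def)
  then have "compose S f h = f" if "f \<in> Homeo S" for f
    using True that by (auto simp: compose_def restrict_def)
  then show ?thesis
    by (intro continuous_map_eq[OF continuous_map_id]) (simp add: topspace_Homeo_topology S)
next
  case False
  let ?m = "submetric (cfunspace (top_of_set S) euclidean_metric) (Homeo S)"
  have sp: "mspace ?m = Homeo S" using Homeo_subset_cfunspace[OF S] by auto
  have im: "h ` S = S" using h by (auto simp: Homeo_def homeomorphism_def)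
  have "mdist ?m (compose S f h) (compose S g h) = mdist ?m f g"
    if f: "f \<in> Homeo S" and g: "g \<in> Homeo S" for f g
  proof -
    have "(SUP x\<in>S. dist (compose S f h x) (compose S g h x)) = (SUP x\<in>S. dist (f (h x)) (g (h x)))"
      by (rule SUP_cong) (auto simp: compose_def)
    also have "\<dots> = (SUP y\<in>h ` S. dist (f y) (g y))" by (simp add: image_image)
    finally show ?thesis
      unfolding im mdist_Homeo[OF S False f g]
        mdist_Homeo[OF S False compose_Homeo[OF f h] compose_Homeo[OF g h]] .
  qed
  then have "Lipschitz_continuous_map ?m ?m (\<lambda>f. compose S f h)"
    unfolding Lipschitz_continuous_map_def sp using compose_Homeo[OF _ h]
    by (intro conjI exI[of _ 1]) auto
  then show ?thesis
    unfolding Homeo_topology_def by (rule Lipschitz_continuous_imp_continuous_map)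
qed

text \<open>If a translate K h of a set \<open>K\<close> of positive measure lies in
  \<open>X\<close>, and so in the Borel hull \<open>B\<close>, then \<open>K\<close> lies in the
  translate of \<open>B\<close> by the inverse of \<open>h\<close>, which should be null.\<close>

lemma not_haar_nullI:
  fixes S :: "'a::metric_space set"
  assumes S: "compact S"
    and catch: "\<And>K. K \<subseteq> Homeo S \<Longrightarrow> biequicontinuous S K \<Longrightarrow> \<exists>h\<in>Homeo S. (\<lambda>k. compose S k h) ` K \<subseteq> X"
  shows "\<not> haar_null (HomeoGroup S) (Homeo_topology S) X"
proof
  interpret G: group "HomeoGroup S" by (rule group_HomeoGroup)
  assume "haar_null (HomeoGroup S) (Homeo_topology S) X"
  then obtain \<mu> B where \<mu>: "prob_space \<mu>" "sets \<mu> = borel_sets_of (Homeo_topology S)"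
    and B: "B \<in> sets \<mu>" "X \<subseteq> B"
    and null: "\<And>g h. g \<in> Homeo S \<Longrightarrow> h \<in> Homeo S \<Longrightarrow> emeasure \<mu> (two_sided_translate (HomeoGroup S) g B h) = 0"
    unfolding haar_null_def by auto
  obtain K where K: "K \<in> sets \<mu>" "K \<subseteq> Homeo S" "biequicontinuous S K" "0 < emeasure \<mu> K"
    using biequicontinuous_set_of_positive_measure[OF S \<mu>] .
  obtain h where h: "h \<in> Homeo S" and hK: "(\<lambda>k. compose S k h) ` K \<subseteq> X"
    using catch[OF K(2,3)] by auto
  have op: "{U. openin (Homeo_topology S) U} \<subseteq> Pow (Homeo S)"
    using openin_subset topspace_Homeo_topology[OF S] by blast
  have sets: "sets \<mu> = sigma_sets (Homeo S) {U. openin (Homeo_topology S) U}"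
    unfolding \<mu>(2) borel_sets_of_def topspace_Homeo_topology[OF S] ..
  have sp: "space \<mu> = Homeo S"
    using space_eq_topspace_borel[OF \<mu>(2)] topspace_Homeo_topology[OF S] by simp
  \<comment> \<open>\<open>emeasure\<close> is 0 on non-measurable sets by default, so the nullity
    of a translate of \<open>B\<close> says something about its subset \<open>K\<close> only once
    that translate is known to be measurable.\<close>
  have "(\<lambda>f. compose S f h) \<in> measurable \<mu> \<mu>"
  proof (rule measurable_sigma_sets[OF sets op])
    show "(\<lambda>f. compose S f h) \<in> space \<mu> \<rightarrow> Homeo S" using compose_Homeo[OF _ h] sp by auto
    fix U assume "U \<in> {U. openin (Homeo_topology S) U}"
    then have "openin (Homeo_topology S) {f \<in> topspace (Homeo_topology S). compose S f h \<in> U}"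
      using continuous_right_translation[OF S h] openin_continuous_map_preimage by blast
    moreover have "{f \<in> topspace (Homeo_topology S). compose S f h \<in> U} = (\<lambda>f. compose S f h) -` U \<inter> space \<mu>"
      unfolding sp topspace_Homeo_topology[OF S] by auto
    ultimately show "(\<lambda>f. compose S f h) -` U \<inter> space \<mu> \<in> sets \<mu>" unfolding sets by auto
  qed
  then have pre: "(\<lambda>f. compose S f h) -` B \<inter> space \<mu> \<in> sets \<mu>" using B(1) measurable_sets by blast
  let ?G = "HomeoGroup S"
  have BH: "B \<subseteq> Homeo S" using B(1) sp sets.sets_into_space by blast
  have hG: "h \<in> carrier ?G" using h by simp
  have "(\<lambda>f. compose S f h) -` B \<inter> space \<mu> = two_sided_translate ?G \<one>\<^bsub>?G\<^esub> B (inv\<^bsub>?G\<^esub> h)"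
  proof (intro Set.set_eqI iffI)
    fix f assume "f \<in> (\<lambda>f. compose S f h) -` B \<inter> space \<mu>"
    then have f: "f \<in> carrier ?G" "f \<otimes>\<^bsub>?G\<^esub> h \<in> B" using sp h by (auto simp: mult_HomeoGroup)
    then have "f = \<one>\<^bsub>?G\<^esub> \<otimes>\<^bsub>?G\<^esub> (f \<otimes>\<^bsub>?G\<^esub> h) \<otimes>\<^bsub>?G\<^esub> inv\<^bsub>?G\<^esub> h"
      using hG G.m_assoc[of f h "inv\<^bsub>?G\<^esub> h"] by (simp del: carrier_HomeoGroup)
    then show "f \<in> two_sided_translate ?G \<one>\<^bsub>?G\<^esub> B (inv\<^bsub>?G\<^esub> h)"
      unfolding two_sided_translate_def using f(2) by blast
  next
    fix f assume "f \<in> two_sided_translate ?G \<one>\<^bsub>?G\<^esub> B (inv\<^bsub>?G\<^esub> h)"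
    then obtain b where b: "b \<in> B" "f = \<one>\<^bsub>?G\<^esub> \<otimes>\<^bsub>?G\<^esub> b \<otimes>\<^bsub>?G\<^esub> inv\<^bsub>?G\<^esub> h"
      unfolding two_sided_translate_def by auto
    have bG: "b \<in> carrier ?G" using b BH by auto
    have "f \<in> carrier ?G" using b(2) bG hG by (simp del: carrier_HomeoGroup)
    moreover have "f \<otimes>\<^bsub>?G\<^esub> h = b"
      using b(2) bG hG G.m_assoc[of b "inv\<^bsub>?G\<^esub> h" h] by (simp del: carrier_HomeoGroup)
    ultimately show "f \<in> (\<lambda>f. compose S f h) -` B \<inter> space \<mu>"
      using b(1) sp h by (simp add: mult_HomeoGroup)
  qed
  moreover have "emeasure \<mu> (two_sided_translate ?G \<one>\<^bsub>?G\<^esub> B (inv\<^bsub>?G\<^esub> h)) = 0"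
    using null G.one_closed G.inv_closed[OF hG] by simp
  ultimately have "emeasure \<mu> ((\<lambda>f. compose S f h) -` B \<inter> space \<mu>) = 0" by simp
  moreover have "K \<subseteq> (\<lambda>f. compose S f h) -` B \<inter> space \<mu>" using hK B(2) K(2) sp by auto
  ultimately show False using emeasure_mono[OF _ pre, of K] K(4) by simp
qed

section \<open>Infinite graphs\<close>

text \<open>
  \<open>W\<close> is a sum of bumps, the \<open>n\<close>-th one oscillating \<open>M n\<close> times between \<open>0\<close> and \<open>a n\<close> on
  \<open>[a n, a n + \<tau> n]\<close>. The frequencies \<open>M n\<close> are arbitrary: continuity only needs \<open>a n\<close> summable.
\<close>

lemma oscillating_function:
  fixes a \<tau> :: "nat \<Rightarrow> real" and M :: "nat \<Rightarrow> nat"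
  assumes a: "a = (\<lambda>n. (1/2) ^ Suc n)" and \<tau>: "\<And>n. 0 < \<tau> n" "\<And>n. \<tau> n \<le> a n" and M: "\<And>n. 0 < M n"
  obtains W :: "real \<Rightarrow> real" where "continuous_on UNIV W" "\<And>t. 0 \<le> W t"
    "\<And>n i. i < M n \<Longrightarrow> W (a n + \<tau> n * (i / M n)) = 0"
    "\<And>n i. i < M n \<Longrightarrow> W (a n + \<tau> n * ((i + 1/2) / M n)) = a n"
proof -
  \<comment> \<open>Clamping t to the interval makes the bump constant on either side; the constant
    is 0 because \<open>M n\<close> is an integer and the sine vanishes at both ends.\<close>
  define w where "w n t = a n * (sin (pi * M n * ((max (a n) (min t (a n + \<tau> n)) - a n) / \<tau> n)))\<^sup>2" for n t
  have a0: "0 < a n" for n by (simp add: a)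
  have w0: "0 \<le> w n t" for n t using a0[of n] by (simp add: w_def)
  have wa: "w n t \<le> a n" for n t
    using a0[of n] by (simp add: w_def abs_square_le_1)
  have suma: "summable a" unfolding a by (simp add: summable_geometric)
  define W where "W t = (\<Sum>n. w n t)" for t
  have ul: "uniform_limit UNIV (\<lambda>n t. \<Sum>i<n. w i t) W sequentially"
    unfolding W_def using w0 wa suma by (intro Weierstrass_m_test[of _ _ a]) auto
  have "continuous_on UNIV W"
    by (rule uniform_limit_theorem[OF _ ul])
      (auto simp: w_def intro!: always_eventually continuous_intros, use \<tau>(1) in \<open>metis less_irrefl\<close>)
  moreover have "0 \<le> W t" for t
  proof -
    have "summable (\<lambda>n. w n t)" by (rule summable_comparison_test'[OF suma, of 0]) (use w0 wa in auto)
    then show ?thesis unfolding W_def by (rule suminf_nonneg) (rule w0)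
  qed
  \<comment> \<open>Since \<tau> n \<le> a n, the n-th interval lies in [a n, 2 a n]. These dyadic
    intervals meet at most in endpoints, where the bumps vanish, so only one term of the series
    survives.\<close>
  moreover have eq: "W t = w n t" if t: "a n \<le> t" "t \<le> a n + \<tau> n" for n t
  proof -
    have z: "w m t = 0" if "m \<noteq> n" for m
    proof (cases "m < n")
      case True
      then have "Suc m \<le> n" by simp
      then have "2 * a n \<le> a m" using power_decreasing[of "Suc m" n "1/2::real"] by (simp add: a)
      then have "max (a m) (min t (a m + \<tau> m)) = a m" using t \<tau>(2)[of n] by auto
      then show ?thesis by (simp add: w_def)
    next
      case False
      then have "Suc n \<le> m" using that by simp
      then have "2 * a m \<le> a n" using power_decreasing[of "Suc n" m "1/2::real"] by (simp add: a)
      then have "max (a m) (min t (a m + \<tau> m)) = a m + \<tau> m" using t \<tau>[of m] a0[of m] by auto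
      then show ?thesis using \<tau>(1)[of m] sin_npi2[of "M m"] by (simp add: w_def mult.commute)
    qed
    have "W t = (\<Sum>m\<in>{n}. w m t)" unfolding W_def by (rule suminf_finite) (use z in auto)
    then show ?thesis by simp
  qed
  moreover have "W (a n + \<tau> n * (i / M n)) = 0" if i: "i < M n" for n i
  proof -
    have b: "0 \<le> i / M n" "i / M n \<le> 1" using i by auto
    have c: "a n \<le> a n + \<tau> n * (i / M n)" "a n + \<tau> n * (i / M n) \<le> a n + \<tau> n"
      using mult_left_mono[OF b(2), of "\<tau> n"] \<tau>(1)[of n] b(1) by auto
    have "max (a n) (min (a n + \<tau> n * (i / M n)) (a n + \<tau> n)) = a n + \<tau> n * (i / M n)" using c by linarith
    moreover have "pi * M n * (\<tau> n * (i / M n) / \<tau> n) = i * pi" using \<tau>(1)[of n] M[of n] by simp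
    ultimately show ?thesis unfolding eq[OF c] w_def by (simp only: add_diff_cancel_left' sin_npi) simp
  qed
  moreover have "W (a n + \<tau> n * ((i + 1/2) / M n)) = a n" if i: "i < M n" for n i
  proof -
    have "real i + 1 \<le> M n" using i by linarith
    then have b: "0 \<le> (i + 1/2) / M n" "(i + 1/2) / M n \<le> 1" using i by (auto simp: divide_simps)
    have c: "a n \<le> a n + \<tau> n * ((i + 1/2) / M n)" "a n + \<tau> n * ((i + 1/2) / M n) \<le> a n + \<tau> n"
      using mult_left_mono[OF b(2), of "\<tau> n"] \<tau>(1)[of n] b(1) by auto
    have "max (a n) (min (a n + \<tau> n * ((i + 1/2) / M n)) (a n + \<tau> n)) = a n + \<tau> n * ((i + 1/2) / M n)"
      using c by linarith
    moreover have "pi * M n * (\<tau> n * ((i + 1/2) / M n) / \<tau> n) = i * pi + pi/2"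
      using \<tau>(1)[of n] M[of n] by (simp add: field_simps)
    moreover have "(sin (i * pi + pi/2))\<^sup>2 = 1"
      by (simp add: sin_add cos_npi power_mult_distrib flip: power_mult)
    ultimately show ?thesis unfolding eq[OF c] w_def by (simp only: add_diff_cancel_left' mult_1_right)
  qed
  ultimately show ?thesis by (intro that)
qed

text \<open>As j differs from i, the map leaves the coordinate that determines the exponent
  unchanged, so the reciprocal exponent inverts it.\<close>

lemma fibrewise_power_Homeo:
  fixes i j :: "'n::finite" and W :: "real \<Rightarrow> real"
  assumes "i \<noteq> j" and W: "continuous_on UNIV W" "\<And>t. 0 \<le> W t"
  shows "restrict (\<lambda>x. \<chi> l. if l = i then x $ i powr (1 + W (x $ j)) else x $ l) unit_cube
    \<in> Homeo (unit_cube :: (real ^ 'n) set)"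
proof -
  let ?S = "unit_cube :: (real ^ 'n) set"
  \<comment> \<open>With the exponent as a parameter, the map and its inverse have the same form,
    and one proof of continuity and invariance serves both.\<close>
  define h where "h V x = (\<chi> l. if l = i then x $ i powr V (x $ j) else x $ l)" for V :: "real \<Rightarrow> real" and x :: "real ^ 'n"
  have cont: "continuous_on ?S (h V)" if V: "continuous_on UNIV V" "\<And>t. 0 < V t" for V
    unfolding h_def
  proof (rule continuous_on_vec_lambda)
    fix l
    have "continuous_on ?S (\<lambda>x. V (x $ j))"
      by (rule continuous_on_compose2[OF V(1)]) (auto intro!: continuous_intros)
    then have "continuous_on ?S (\<lambda>x. x $ i powr V (x $ j))"
      by (intro continuous_on_powr') (auto intro!: continuous_intros V(2))
    then show "continuous_on ?S (\<lambda>x. if l = i then x $ i powr V (x $ j) else x $ l)"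
      by (cases "l = i") (auto intro!: continuous_intros)
  qed
  have maps: "h V x \<in> ?S" if V: "\<And>t. 0 < V t" and x: "x \<in> ?S" for V x
  proof -
    have "x $ i powr V (x $ j) \<le> 1 powr V (x $ j)"
      using x V[of "x $ j"] by (intro powr_mono2) auto
    then show ?thesis using x by (auto simp: h_def)
  qed
  have inv: "h (\<lambda>t. 1 / V t) (h V x) = x" "h V (h (\<lambda>t. 1 / V t) x) = x"
    if V: "\<And>t. 0 < V t" and x: "x \<in> ?S" for V x
    using x V[of "x $ j"] \<open>i \<noteq> j\<close> by (auto simp: h_def vec_eq_iff powr_powr)
  define V where "V t = 1 + W t" for t
  have V0: "0 < V t" for t using W(2)[of t] by (simp add: V_def)
  have Vc: "continuous_on UNIV V" unfolding V_def by (intro continuous_intros W(1))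
  have V': "continuous_on UNIV (\<lambda>t. 1 / V t)"
    using V0 by (intro continuous_intros Vc) (metis less_irrefl UNIV_I)
  have "homeomorphism ?S ?S (h V) (h (\<lambda>t. 1 / V t))"
  proof (rule homeomorphismI)
    show "continuous_on ?S (h V)" by (rule cont[OF Vc V0])
    show "continuous_on ?S (h (\<lambda>t. 1 / V t))" by (rule cont[OF V']) (use V0 in auto)
    show "h V ` ?S \<subseteq> ?S" using maps[of V, OF V0] by blast
    show "h (\<lambda>t. 1 / V t) ` ?S \<subseteq> ?S" using maps[of "\<lambda>t. 1 / V t"] V0 by (simp add: image_subset_iff)
  qed (use inv[of V, OF V0] in auto)
  then have "homeomorphism ?S ?S (restrict (h V) ?S) (h (\<lambda>t. 1 / V t))"
    by (rule homeomorphism_cong) auto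
  then have "restrict (h V) ?S \<in> Homeo ?S" unfolding Homeo_def by blast
  then show ?thesis unfolding h_def[abs_def] V_def .
qed

section \<open>Slabs that every member of an equicontinuous set separates\<close>

lemma dist_le_card_mult:
  fixes x y :: "real ^ 'n"
  assumes "\<And>l. \<bar>x $ l - y $ l\<bar> \<le> r"
  shows "dist x y \<le> real CARD('n) * r"
proof -
  have "dist x y \<le> (\<Sum>l\<in>UNIV. \<bar>(x - y) $ l\<bar>)"
    unfolding dist_norm by (rule norm_le_l1_cart)
  also have "\<dots> \<le> (\<Sum>l\<in>(UNIV :: 'n set). r)" by (rule sum_mono) (use assms in simp)
  finally show ?thesis by simp
qed

text \<open>
  A thin slab of the hyperplane \<open>y\<^sub>i = c\<close> around the point with \<open>y\<^sub>j = s\<close> and remaining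
  coordinates \<open>1/2\<close>.
\<close>

definition window :: "'n::finite \<Rightarrow> 'n \<Rightarrow> real \<Rightarrow> real \<Rightarrow> real \<Rightarrow> (real ^ 'n) set" where
  "window i j s \<tau> c = {y \<in> unit_cube. y $ i = c \<and> s \<le> y $ j \<and> y $ j \<le> s + \<tau> \<and>
     (\<forall>l. l \<noteq> i \<longrightarrow> l \<noteq> j \<longrightarrow> 1/2 \<le> y $ l \<and> y $ l \<le> 1/2 + \<tau>)}"

text \<open>One \<tau> serves as width of the slabs and as gap between the values, so that the
  region swept out later is a cube.\<close>

definition splits_windows :: "'n::finite \<Rightarrow> 'n \<Rightarrow> real \<Rightarrow> real \<Rightarrow> real \<Rightarrow> real \<Rightarrow> (real ^ 'n \<Rightarrow> real) \<Rightarrow> real \<Rightarrow> bool"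
  where "splits_windows i j s \<tau> c c' v \<alpha> \<longleftrightarrow>
     (\<forall>y\<in>window i j s \<tau> c. v y \<le> \<alpha>) \<and> (\<forall>y\<in>window i j s \<tau> c'. \<alpha> + \<tau> \<le> v y)"

text \<open>The modulus of the inverses keeps the images of the two slab centres apart, and the
  modulus of \<open>K\<close> keeps the image of each thin slab near that of its centre. The
  coordinate and the direction of the gap depend on k, but \<tau>0 does not.\<close>

lemma biequicontinuous_splits_windows:
  fixes K :: "(real ^ 'n \<Rightarrow> real ^ 'n) set"
  assumes K: "biequicontinuous unit_cube K" and "i \<noteq> j"
    and s: "0 \<le> s" "s \<le> 1" and c: "0 \<le> c" "c \<le> 1" "0 \<le> c'" "c' \<le> 1" "c \<noteq> c'"
  obtains \<tau>0 where "0 < \<tau>0"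
    "\<And>\<tau> k. \<tau> \<le> \<tau>0 \<Longrightarrow> k \<in> K \<Longrightarrow>
       \<exists>l \<alpha>. splits_windows i j s \<tau> c c' (\<lambda>y. k y $ l) \<alpha> \<or> splits_windows i j s \<tau> c' c (\<lambda>y. k y $ l) \<alpha>"
proof -
  define P :: "real \<Rightarrow> real ^ 'n" where "P b = (\<chi> l. if l = i then b else if l = j then s else 1/2)" for b
  define D where "D = real CARD('n)"
  have D: "0 < D" by (simp add: D_def)
  have PS: "P c \<in> unit_cube" "P c' \<in> unit_cube" using s c by (auto simp: P_def)
  have "\<bar>c - c'\<bar> \<le> dist (P c) (P c')"
    using component_le_norm_cart[of "P c - P c'" i] by (simp add: P_def dist_norm)
  moreover have "0 < \<bar>c - c'\<bar>" using c(5) by simp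
  then obtain \<delta>1 where \<delta>1: "0 < \<delta>1" "K \<subseteq> modulus_set unit_cube \<bar>c - c'\<bar> \<delta>1"
    using K unfolding biequicontinuous_def by blast
  ultimately have far: "\<delta>1 \<le> dist (k (P c)) (k (P c'))" if "k \<in> K" for k
    using that PS unfolding modulus_set_def by blast
  \<comment> \<open>If all coordinates of the images of the centres differed by at most 3 \<eta>,
    their distance would be at most 3/4 \<delta>1. Each slab costs a further \<eta>, which leaves a
    gap of at least \<eta> \<ge> \<tau>.\<close>
  define \<eta> where "\<eta> = \<delta>1 / (4 * D)"
  have \<eta>: "0 < \<eta>" using \<delta>1 D by (simp add: \<eta>_def)
  obtain \<delta>2 where \<delta>2: "0 < \<delta>2" "K \<subseteq> modulus_set unit_cube \<eta> \<delta>2"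
    using K \<eta> unfolding biequicontinuous_def by blast
  define \<tau>0 where "\<tau>0 = min \<eta> (\<delta>2 / D)"
  have near: "\<bar>k y $ l - k (P b) $ l\<bar> \<le> \<eta>"
    if k: "k \<in> K" and b: "b \<in> {c, c'}" and \<tau>: "\<tau> \<le> \<tau>0" and y: "y \<in> window i j s \<tau> b" for k b \<tau> y l
  proof (cases "0 \<le> \<tau>")
    case True
    have "\<bar>y $ l - P b $ l\<bar> \<le> \<tau>" for l
      using y True \<open>i \<noteq> j\<close> unfolding window_def P_def by (cases "l = i"; cases "l = j") auto
    then have "dist y (P b) \<le> D * \<tau>" unfolding D_def by (rule dist_le_card_mult)
    also have "\<dots> \<le> D * (\<delta>2 / D)" using \<tau> D by (intro mult_left_mono) (auto simp: \<tau>0_def)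
    also have "\<dots> = \<delta>2" using D by simp
    finally have "dist (k y) (k (P b)) \<le> \<eta>"
      using \<delta>2(2) k y b PS unfolding modulus_set_def window_def by blast
    then show ?thesis using component_le_norm_cart[of "k y - k (P b)" l] by (simp add: dist_norm)
  next
    case False
    then have "window i j s \<tau> b = {}" by (auto simp: window_def)
    then show ?thesis using y by simp
  qed
  have "\<exists>l \<alpha>. splits_windows i j s \<tau> c c' (\<lambda>y. k y $ l) \<alpha> \<or> splits_windows i j s \<tau> c' c (\<lambda>y. k y $ l) \<alpha>"
    if \<tau>: "\<tau> \<le> \<tau>0" and k: "k \<in> K" for \<tau> k
  proof -
    have "\<exists>l. 3 * \<eta> < \<bar>k (P c) $ l - k (P c') $ l\<bar>"
    proof (rule ccontr)
      assume "\<not> ?thesis"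
      then have "dist (k (P c)) (k (P c')) \<le> D * (3 * \<eta>)"
        unfolding D_def by (intro dist_le_card_mult) (simp add: not_less)
      also have "\<dots> < \<delta>1" using D \<delta>1 by (simp add: \<eta>_def)
      finally show False using far[OF k] by simp
    qed
    then obtain l where l: "3 * \<eta> < \<bar>k (P c) $ l - k (P c') $ l\<bar>" ..
    have \<tau>': "\<tau> \<le> \<eta>" using \<tau> by (simp add: \<tau>0_def)
    note nc = near[OF k insertI1 \<tau>, of _ l] and nc' = near[OF k insertI2[OF singletonI] \<tau>, of _ l]
    show ?thesis
    proof (cases "k (P c) $ l < k (P c') $ l")
      case True
      have "splits_windows i j s \<tau> c c' (\<lambda>y. k y $ l) (k (P c) $ l + \<eta>)"
        unfolding splits_windows_def using nc nc' l True \<tau>' by fastforce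
      then show ?thesis by blast
    next
      case False
      have "splits_windows i j s \<tau> c' c (\<lambda>y. k y $ l) (k (P c') $ l + \<eta>)"
        unfolding splits_windows_def using nc nc' l False \<tau>' by fastforce
      then show ?thesis by blast
    qed
  qed
  moreover have "0 < \<tau>0" using \<eta> \<delta>2 D by (simp add: \<tau>0_def)
  ultimately show ?thesis by (intro that)
qed

text \<open>No order between x and y is assumed, since either slab may be met first.\<close>

lemma interval_image_hits:
  fixes f :: "real \<Rightarrow> real"
  assumes "continuous_on {a..b} f" "x \<in> {a..b}" "y \<in> {a..b}" "f x \<le> v" "v \<le> f y"
  obtains t where "t \<in> {a..b}" "f t = v"
proof -
  have "connected (f ` {a..b})" by (rule connected_continuous_image[OF assms(1)]) simp
  then have "v \<in> f ` {a..b}" using assms(2-5) unfolding connected_iff_interval by blast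
  then show ?thesis using that by auto
qed

text \<open>
  Along the segment \<open>t0 \<le> x\<^sub>j \<le> t1\<close> with the other coordinates fixed, the \<open>i\<close>-th coordinate of \<open>h x\<close>
  moves from at least \<open>1/2\<close> to at most \<open>p\<close>, so \<open>h x\<close> meets both windows; the intermediate value theorem,
  applied twice, replaces a Poincare-Miranda argument.
\<close>

lemma fibre_hits:
  fixes v :: "real ^ 'n \<Rightarrow> real" and h :: "real ^ 'n \<Rightarrow> real ^ 'n"
  assumes "i \<noteq> j" and W: "continuous_on UNIV W" "\<And>t. 0 \<le> W t"
    and h: "h = (\<lambda>x. \<chi> l. if l = i then x $ i powr (1 + W (x $ j)) else x $ l)"
    and v: "continuous_on unit_cube v"
    and t: "0 \<le> s" "s \<le> t0" "t0 \<le> t1" "t1 \<le> s + \<tau>" "s + \<tau> \<le> 1" "W t0 = 0" "W t1 = a"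
    and \<tau>: "\<tau> \<le> 1/2" and p: "0 \<le> p" "p \<le> 1/2" "(1/2 + \<tau>) powr (1 + a) \<le> p"
    and split: "splits_windows i j s \<tau> (1/2) p v \<alpha> \<or> splits_windows i j s \<tau> p (1/2) v \<alpha>"
    and \<xi>: "\<And>l. l \<noteq> j \<Longrightarrow> 1/2 \<le> \<xi> $ l \<and> \<xi> $ l \<le> 1/2 + \<tau>" "\<alpha> \<le> \<xi> $ j" "\<xi> $ j \<le> \<alpha> + \<tau>"
  obtains x where "x \<in> unit_cube" "t0 \<le> x $ j" "x $ j \<le> t1" "\<And>l. l \<noteq> j \<Longrightarrow> x $ l = \<xi> $ l"
    "v (h x) = \<xi> $ j"
proof -
  define X where "X t = (\<chi> l. if l = j then t else \<xi> $ l)" for t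
  define e where "e t = \<xi> $ i powr (1 + W t)" for t
  have XS: "X t \<in> unit_cube" if "t \<in> {t0..t1}" for t
    using that t \<tau> \<xi>(1) by (fastforce simp: X_def)
  have \<xi>i: "1/2 \<le> \<xi> $ i" "\<xi> $ i \<le> 1/2 + \<tau>" using \<xi>(1) \<open>i \<noteq> j\<close> by auto
  have hX: "h (X t) = (\<chi> l. if l = i then e t else if l = j then t else \<xi> $ l)" for t
    using \<open>i \<noteq> j\<close> by (auto simp: h X_def e_def vec_eq_iff)
  have e01: "0 \<le> e t" "e t \<le> 1" for t
    using \<xi>i \<tau> W(2)[of t] powr_mono2[of "1 + W t" "\<xi> $ i" 1] by (auto simp: e_def)
  have hS: "h (X t) \<in> unit_cube" if "t \<in> {t0..t1}" for t
    using XS[OF that, unfolded X_def] e01[of t] by (auto simp: hX split: if_splits)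
  have ce: "continuous_on {t0..t1} e"
    unfolding e_def using \<xi>i
    by (intro continuous_intros continuous_on_subset[OF W(1)]) auto
  have chX: "continuous_on {t0..t1} (\<lambda>t. h (X t))"
    unfolding hX
  proof (rule continuous_on_vec_lambda)
    show "continuous_on {t0..t1} (\<lambda>t. if l = i then e t else if l = j then t else \<xi> $ l)" for l
      using ce by (cases "l = i"; cases "l = j") auto
  qed
  have cv: "continuous_on {t0..t1} (\<lambda>t. v (h (X t)))"
    by (rule continuous_on_compose2[OF v chX]) (use hS in blast)
  have e0: "1/2 \<le> e t0" using \<xi>i t by (simp add: e_def)
  have "e t1 \<le> (1/2 + \<tau>) powr (1 + a)"
    unfolding e_def t(7) using \<xi>i W(2)[of t1] t(7) by (intro powr_mono2) auto
  with p have e1: "e t1 \<le> p" by simp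
  have win: "h (X t) \<in> window i j s \<tau> (e t)" if "t \<in> {t0..t1}" for t
    using hS[OF that] that \<xi>(1) t \<open>i \<noteq> j\<close> unfolding window_def by (auto simp: hX)
  have mem: "t0 \<in> {t0..t1}" "t1 \<in> {t0..t1}" using t by auto
  \<comment> \<open>The windows lie in hyperplanes, so parameters are needed at which the i-th
    coordinate equals 1/2 and p exactly.\<close>
  obtain u where u: "u \<in> {t0..t1}" "e u = 1/2"
    using interval_image_hits[OF ce mem(2,1), of "1/2"] e0 e1 p by auto
  obtain u' where u': "u' \<in> {t0..t1}" "e u' = p"
    using interval_image_hits[OF ce mem(2,1), of p] e0 e1 p by auto
  have "\<exists>q\<in>{t0..t1}. \<exists>r\<in>{t0..t1}. v (h (X q)) \<le> \<xi> $ j \<and> \<xi> $ j \<le> v (h (X r))"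
    using split win[OF u(1)] win[OF u'(1)] u u' \<xi>(2,3) unfolding splits_windows_def by (metis order_trans)
  then obtain t where "t \<in> {t0..t1}" "v (h (X t)) = \<xi> $ j"
    using interval_image_hits[OF cv, of _ _ "\<xi> $ j"] by metis
  then show ?thesis using XS by (intro that[of "X t"]) (auto simp: X_def)
qed

section \<open>The projection of the graph and the estimate at one scale\<close>

lemma dist_vec_sq: "(dist x y)\<^sup>2 = (\<Sum>l\<in>UNIV. (x $ l - y $ l)\<^sup>2)" for x y :: "real ^ 'n"
  by (simp add: dist_vec_def L2_set_def sum_nonneg dist_real_def)

definition replace_coordinate :: "'n::finite \<Rightarrow> 'n \<Rightarrow> (real ^ 'n) \<times> (real ^ 'n) \<Rightarrow> real ^ 'n" where
  "replace_coordinate j l z = (\<chi> m. if m = j then snd z $ l else fst z $ m)"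

text \<open>The map selects d distinct ones among the 2 d coordinates of the pair.\<close>

lemma replace_coordinate_nonexpansive:
  "dist (replace_coordinate j l z) (replace_coordinate j l w) \<le> dist z w"
proof -
  have "(dist (replace_coordinate j l z) (replace_coordinate j l w))\<^sup>2
      = (snd z $ l - snd w $ l)\<^sup>2 + (\<Sum>m\<in>UNIV - {j}. (fst z $ m - fst w $ m)\<^sup>2)"
    unfolding dist_vec_sq by (subst sum.remove[of _ j]) (auto simp: replace_coordinate_def)
  also have "\<dots> \<le> (dist (snd z) (snd w))\<^sup>2 + (dist (fst z) (fst w))\<^sup>2"
    unfolding dist_vec_sq
    by (intro add_mono member_le_sum[of l UNIV "\<lambda>l. (snd z $ l - snd w $ l)\<^sup>2"] sum_mono2) auto
  also have "\<dots> = (dist z w)\<^sup>2" by (simp add: dist_prod_def)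
  finally show ?thesis by (rule power2_le_imp_le) simp
qed

text \<open>Everything here depends on \<open>K\<close> and the amplitude a only, so the frequency
  can still be chosen afterwards.\<close>

lemma biequicontinuous_scale:
  fixes K :: "(real ^ 'n \<Rightarrow> real ^ 'n) set"
  assumes K: "biequicontinuous unit_cube K" and "i \<noteq> j" and a: "0 < a" "a \<le> 1/2"
  obtains \<tau> p where "0 < \<tau>" "\<tau> \<le> a" "0 \<le> p" "p \<le> 1/2" "(1/2 + \<tau>) powr (1 + a) \<le> p"
    "\<And>k. k \<in> K \<Longrightarrow> \<exists>l \<alpha>. splits_windows i j a \<tau> (1/2) p (\<lambda>y. k y $ l) \<alpha>
                      \<or> splits_windows i j a \<tau> p (1/2) (\<lambda>y. k y $ l) \<alpha>"
proof -
  define b where "b = (1/2::real) powr (1 + a)"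
  have b: "0 < b" "b < 1/2"
    using powr_less_mono'[of "1/2::real" 1 "1 + a"] a by (auto simp: b_def)
  define p where "p = (b + 1/2) / 2"
  have p: "b < p" "p < 1/2" "0 < p" using b by (auto simp: p_def)
  \<comment> \<open>\<tau>1 solves (1/2 + \<tau>1) powr (1 + a) = p; it is positive because p
    exceeds the value b of that power at 1/2.\<close>
  define \<tau>1 where "\<tau>1 = p powr (1 / (1 + a)) - 1/2"
  have "b powr (1 / (1 + a)) = 1/2" using a by (simp add: b_def powr_powr)
  moreover have "b powr (1 / (1 + a)) < p powr (1 / (1 + a))"
    using a b p by (intro powr_less_mono2) auto
  ultimately have \<tau>1: "0 < \<tau>1" by (simp add: \<tau>1_def)
  have "1/2 \<noteq> p" using p by simp
  then obtain \<tau>0 where \<tau>0: "0 < \<tau>0" "\<And>\<tau> k. \<tau> \<le> \<tau>0 \<Longrightarrow> k \<in> K \<Longrightarrow>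
       \<exists>l \<alpha>. splits_windows i j a \<tau> (1/2) p (\<lambda>y. k y $ l) \<alpha> \<or> splits_windows i j a \<tau> p (1/2) (\<lambda>y. k y $ l) \<alpha>"
    using biequicontinuous_splits_windows[OF K \<open>i \<noteq> j\<close>, of a "1/2" p] a p by auto
  define \<tau> where "\<tau> = min \<tau>0 (min \<tau>1 a)"
  have \<tau>: "0 < \<tau>" "\<tau> \<le> a" "\<tau> \<le> \<tau>0" "\<tau> \<le> \<tau>1" using \<tau>0(1) \<tau>1 a by (auto simp: \<tau>_def)
  have "(1/2 + \<tau>) powr (1 + a) \<le> (p powr (1 / (1 + a))) powr (1 + a)"
    using \<tau> a by (intro powr_mono2) (auto simp: \<tau>1_def)
  also have "\<dots> = p" using a p by (simp add: powr_powr)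
  finally show ?thesis using that[of \<tau> p] \<tau> p \<tau>0(2)[OF \<tau>(3)] by simp
qed

text \<open>Only the first half of each oscillation is used. There W runs from 0 to a, so by
  \<open>fibre_hits\<close> the part \<open>P m\<close> of the graph projects onto the whole cube
  \<open>E\<close>.\<close>

lemma hausdorff_measure_graph_ge:
  fixes f h :: "real ^ 'n \<Rightarrow> real ^ 'n" and M :: nat
  assumes "i \<noteq> j" and W: "continuous_on UNIV W" "\<And>t. 0 \<le> W t"
    and h: "h = (\<lambda>x. \<chi> l. if l = i then x $ i powr (1 + W (x $ j)) else x $ l)"
    and k: "continuous_on unit_cube k" and f: "\<And>x. x \<in> unit_cube \<Longrightarrow> f x = k (h x)"
    and a: "a \<le> 1/2" and \<tau>: "0 < \<tau>" "\<tau> \<le> a"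
    and M: "0 < M" "\<And>m. m < M \<Longrightarrow> W (a + \<tau> * (m / M)) = 0" "\<And>m. m < M \<Longrightarrow> W (a + \<tau> * ((m + 1/2) / M)) = a"
    and p: "0 \<le> p" "p \<le> 1/2" "(1/2 + \<tau>) powr (1 + a) \<le> p"
    and split: "splits_windows i j a \<tau> (1/2) p (\<lambda>y. k y $ l) \<alpha> \<or> splits_windows i j a \<tau> p (1/2) (\<lambda>y. k y $ l) \<alpha>"
  shows "of_nat M * ennreal (\<tau> ^ CARD('n)) \<le> 2 ^ CARD('n) * hausdorff_measure (real CARD('n)) (graph_on unit_cube f)"
proof -
  define t0 t1 where "t0 m = a + \<tau> * (real m / M)" and "t1 m = a + \<tau> * ((real m + 1/2) / M)" for m
  define P where "P m = {(x, f x) | x. x \<in> unit_cube \<and> t0 m \<le> x $ j \<and> x $ j \<le> t1 m}" for m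
  \<comment> \<open>Coordinate j starts at \<alpha> because the projection shows the output
    coordinate l of k there.\<close>
  define A :: "real ^ 'n" where "A = (\<chi> m. if m = j then \<alpha> else 1/2)"
  define E where "E = cbox A (A + (\<chi> m. \<tau>))"
  have "A \<in> E" using \<tau> by (simp add: E_def mem_box_cart)
  then have ne: "cbox A (A + (\<chi> m. \<tau>)) \<noteq> {}" by (auto simp: E_def)
  have "emeasure lborel E = ennreal (measure lborel E)"
    unfolding E_def by (intro emeasure_eq_ennreal_measure) (use emeasure_lborel_cbox_finite in \<open>auto simp: less_top\<close>)
  also have "measure lborel E = \<tau> ^ CARD('n)"
    unfolding E_def by (simp add: content_cbox_cart[OF ne])
  finally have E: "emeasure lborel E = ennreal (\<tau> ^ CARD('n))" .
  \<comment> \<open>The skipped second half of an oscillation has length \<tau> / (2 M) and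
    separates consecutive pieces in coordinate j.\<close>
  have sep: "\<tau> / (2 * M) \<le> dist z w" if mm: "m \<noteq> m'" and z: "z \<in> P m" and w: "w \<in> P m'" for m m' z w
    using that
  proof (induction m m' arbitrary: z w rule: linorder_wlog)
    case (le m m')
    then have "(real m + 1) / M \<le> real m' / M" by (intro divide_right_mono) auto
    then have "a + \<tau> * ((real m + 1) / M) \<le> t0 m'"
      unfolding t0_def using \<tau>(1) by (intro add_left_mono mult_left_mono) auto
    moreover have "t1 m + \<tau> / (2 * M) = a + \<tau> * ((real m + 1) / M)"
      using M(1) by (simp add: t1_def field_simps)
    ultimately have "t1 m + \<tau> / (2 * M) \<le> t0 m'" by simp
    moreover have "fst z $ j \<le> t1 m" "t0 m' \<le> fst w $ j" using le by (auto simp: P_def)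
    ultimately have "\<tau> / (2 * M) \<le> \<bar>(fst z - fst w) $ j\<bar>" by simp
    also have "\<dots> \<le> dist (fst z) (fst w)" unfolding dist_norm by (rule component_le_norm_cart)
    also have "\<dots> \<le> dist z w" by (rule dist_fst_le)
    finally show ?case .
  next
    case (sym m m')
    then show ?case by (metis dist_commute)
  qed
  have sub: "P m \<subseteq> graph_on unit_cube f" for m by (auto simp: P_def graph_on_def)
  have cov: "E \<subseteq> replace_coordinate j l ` P m" if m: "m < M" for m
  proof
    fix \<xi> assume "\<xi> \<in> E"
    then have box: "A $ q \<le> \<xi> $ q \<and> \<xi> $ q \<le> A $ q + \<tau>" for q by (simp add: E_def mem_box_cart)
    have "real m + 1 \<le> M" using m by linarith
    then have frac: "0 \<le> real m / M" "real m / M \<le> (real m + 1/2) / M" "(real m + 1/2) / M \<le> 1"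
      using M(1) by (auto simp: divide_simps)
    have ts: "a \<le> t0 m" "t0 m \<le> t1 m" "t1 m \<le> a + \<tau>"
      using mult_left_mono[OF frac(2), of \<tau>] mult_left_mono[OF frac(3), of \<tau>] frac(1) \<tau>
      by (auto simp: t0_def t1_def)
    obtain x where "x \<in> unit_cube" "t0 m \<le> x $ j" "x $ j \<le> t1 m" "\<And>q. q \<noteq> j \<Longrightarrow> x $ q = \<xi> $ q" "k (h x) $ l = \<xi> $ j"
    proof (rule fibre_hits[OF \<open>i \<noteq> j\<close> W h _ _ ts _ _ _ _ p split])
      show "continuous_on unit_cube (\<lambda>y. k y $ l)" by (intro continuous_intros k)
      show "W (t0 m) = 0" "W (t1 m) = a" using M m by (simp_all add: t0_def t1_def)
      show "1/2 \<le> \<xi> $ q \<and> \<xi> $ q \<le> 1/2 + \<tau>" if "q \<noteq> j" for q using box[of q] that by (simp add: A_def)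
      show "\<alpha> \<le> \<xi> $ j" "\<xi> $ j \<le> \<alpha> + \<tau>" using box[of j] by (auto simp: A_def)
    qed (use a \<tau> in auto)
    then show "\<xi> \<in> replace_coordinate j l ` P m"
      by (intro image_eqI[of _ _ "(x, f x)"]) (auto simp: P_def replace_coordinate_def vec_eq_iff f)
  qed
  show ?thesis
    using hausdorff_measure_ge_multiplicity[OF replace_coordinate_nonexpansive, of "{..<M}" "\<tau> / (2 * M)" P
        "graph_on unit_cube f" E j l] sep sub cov \<tau> M(1) by (simp add: E)
qed

text \<open>The order of choice lets one h serve all of \<open>K\<close>: amplitudes a n first, then
  \<tau> n and p n from the moduli of \<open>K\<close>, the frequencies M n last. The coordinate l
  and the threshold \<alpha> may vary with k and n, as h does not involve them.\<close>

lemma biequicontinuous_infinite_graph: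
  fixes K :: "(real ^ 'n \<Rightarrow> real ^ 'n) set"
  assumes "CARD('n) \<ge> 2" and KH: "K \<subseteq> Homeo unit_cube" and K: "biequicontinuous unit_cube K"
  obtains h where "h \<in> Homeo unit_cube"
    "\<And>k. k \<in> K \<Longrightarrow> hausdorff_measure (real CARD('n)) (graph_on unit_cube (compose unit_cube k h)) = \<infinity>"
proof -
  let ?d = "CARD('n)"
  obtain i j :: 'n where ij: "i \<noteq> j"
    using assms(1) card_le_Suc0_iff_eq[of "UNIV :: 'n set"] by fastforce
  define a where "a = (\<lambda>n. (1/2::real) ^ Suc n)"
  have a: "0 < a n" "a n \<le> 1/2" for n
    using power_le_one[of "1/2::real" n] by (auto simp: a_def)
  have "\<exists>\<tau> p. 0 < \<tau> \<and> \<tau> \<le> a n \<and> 0 \<le> p \<and> p \<le> 1/2 \<and> (1/2 + \<tau>) powr (1 + a n) \<le> p \<and>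
      (\<forall>k\<in>K. \<exists>l \<alpha>. splits_windows i j (a n) \<tau> (1/2) p (\<lambda>y. k y $ l) \<alpha>
                \<or> splits_windows i j (a n) \<tau> p (1/2) (\<lambda>y. k y $ l) \<alpha>)" for n
    by (rule biequicontinuous_scale[OF K ij a[of n]]) blast
  then obtain \<tau> p where \<tau>: "\<And>n. 0 < \<tau> n" "\<And>n. \<tau> n \<le> a n"
    and p: "\<And>n. 0 \<le> p n" "\<And>n. p n \<le> 1/2" "\<And>n. (1/2 + \<tau> n) powr (1 + a n) \<le> p n"
    and split: "\<And>n k. k \<in> K \<Longrightarrow> \<exists>l \<alpha>. splits_windows i j (a n) (\<tau> n) (1/2) (p n) (\<lambda>y. k y $ l) \<alpha>
                \<or> splits_windows i j (a n) (\<tau> n) (p n) (1/2) (\<lambda>y. k y $ l) \<alpha>"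
    by metis
  \<comment> \<open>The factor 2 ^ d offsets the constant lost in the covering estimate, so that
    scale n alone forces measure at least n.\<close>
  have "\<exists>M. 0 < M \<and> real n * 2 ^ ?d \<le> real M * \<tau> n ^ ?d" for n
  proof -
    obtain M where M: "real n * 2 ^ ?d / \<tau> n ^ ?d < real M" using reals_Archimedean2 by blast
    have "0 < \<tau> n ^ ?d" using \<tau>(1) by simp
    then have "real n * 2 ^ ?d < real M * \<tau> n ^ ?d" using M by (simp add: pos_divide_less_eq)
    then have "real n * 2 ^ ?d \<le> real (Suc M) * \<tau> n ^ ?d"
      using \<open>0 < \<tau> n ^ ?d\<close> by (simp add: distrib_right)
    then show ?thesis by blast
  qed
  then obtain M where M: "\<And>n. 0 < M n" "\<And>n. real n * 2 ^ ?d \<le> real (M n) * \<tau> n ^ ?d" by metis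
  obtain W where W: "continuous_on UNIV W" "\<And>t. 0 \<le> W t"
    and W0: "\<And>n m. m < M n \<Longrightarrow> W (a n + \<tau> n * (real m / M n)) = 0"
    and Wa: "\<And>n m. m < M n \<Longrightarrow> W (a n + \<tau> n * ((real m + 1/2) / M n)) = a n"
    using oscillating_function[of a \<tau> M, OF a_def \<tau> M(1)] by metis
  define h0 :: "real ^ 'n \<Rightarrow> real ^ 'n"
    where "h0 = (\<lambda>x. \<chi> l. if l = i then x $ i powr (1 + W (x $ j)) else x $ l)"
  define h where "h = restrict h0 unit_cube"
  have hH: "h \<in> Homeo unit_cube"
    unfolding h_def h0_def by (rule fibrewise_power_Homeo[OF ij W])
  moreover have "hausdorff_measure (real ?d) (graph_on unit_cube (compose unit_cube k h)) = \<infinity>" (is "?H = _")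
    if k: "k \<in> K" for k
  proof -
    have kc: "continuous_on unit_cube k" using KH k by (auto simp: Homeo_def homeomorphism_def)
    have le: "of_nat n \<le> ?H" for n
    proof -
      obtain l \<alpha> where s: "splits_windows i j (a n) (\<tau> n) (1/2) (p n) (\<lambda>y. k y $ l) \<alpha>
                \<or> splits_windows i j (a n) (\<tau> n) (p n) (1/2) (\<lambda>y. k y $ l) \<alpha>"
        using split[OF k] by blast
      have "2 ^ ?d * of_nat n = ennreal (real n * 2 ^ ?d)"
        by (simp add: ennreal_mult ennreal_power[symmetric] ennreal_of_nat_eq_real_of_nat mult.commute)
      also have "\<dots> \<le> ennreal (real (M n) * \<tau> n ^ ?d)" by (rule ennreal_leI[OF M(2)])
      also have "\<dots> = of_nat (M n) * ennreal (\<tau> n ^ ?d)"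
        using \<tau>(1)[of n] by (simp add: ennreal_mult ennreal_of_nat_eq_real_of_nat)
      also have "\<dots> \<le> 2 ^ ?d * ?H"
        by (rule hausdorff_measure_graph_ge[OF ij W h0_def kc _ a(2) \<tau>(1,2) M(1) W0 Wa p s])
          (auto simp: compose_def h_def)
      finally show ?thesis
        by (subst (asm) ennreal_mult_le_mult_iff) (simp_all add: power_eq_top_ennreal)
    qed
    show ?thesis
    proof (rule ccontr)
      assume "?H \<noteq> \<infinity>"
      then obtain n where "?H < of_nat n" using ennreal_Ex_less_of_nat[of ?H] by (auto simp: less_top)
      then show False using le[of n] by simp
    qed
  qed
  ultimately show ?thesis using that by blast
qed

theorem theorem6p3:
  fixes F :: "(real ^ 'n \<Rightarrow> real ^ 'n) set"
  assumes "CARD('n) \<ge> 2"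
    and "F = {f \<in> Homeo unit_cube. hausdorff_measure (real CARD('n)) (graph_on unit_cube f) = \<infinity>}"
  shows "compact_catcher (HomeoGroup unit_cube) (Homeo_topology unit_cube) F
       \<and> \<not> haar_null (HomeoGroup unit_cube) (Homeo_topology unit_cube) F"
proof -
  let ?S = "unit_cube :: (real ^ 'n) set"
  have S: "compact ?S"
  proof -
    have "?S = cbox (\<chi> i. 0) (\<chi> i. 1)" by (auto simp: mem_box_cart)
    then show ?thesis by (simp only: compact_cbox)
  qed
  have catch: "\<exists>h\<in>Homeo ?S. (\<lambda>k. compose ?S k h) ` K \<subseteq> F"
    if K: "K \<subseteq> Homeo ?S" "biequicontinuous ?S K" for K
  proof -
    obtain h where "h \<in> Homeo ?S"
      "\<And>k. k \<in> K \<Longrightarrow> hausdorff_measure (real CARD('n)) (graph_on ?S (compose ?S k h)) = \<infinity>"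
      by (rule biequicontinuous_infinite_graph[OF assms(1) K]) blast
    then show ?thesis using K(1) unfolding assms(2) by (auto intro!: bexI[of _ h] compose_Homeo)
  qed
  interpret G: group "HomeoGroup ?S" by (rule group_HomeoGroup)
  have "compact_catcher (HomeoGroup ?S) (Homeo_topology ?S) F"
    unfolding compact_catcher_def
  proof (intro conjI allI impI)
    show "F \<subseteq> carrier (HomeoGroup ?S)" by (auto simp: assms(2))
    fix K assume K: "compactin (Homeo_topology ?S) K"
    then have KH: "K \<subseteq> Homeo ?S"
      using compactin_subset_topspace topspace_Homeo_topology[OF S] by blast
    obtain h where h: "h \<in> Homeo ?S" "(\<lambda>k. compose ?S k h) ` K \<subseteq> F"
      using catch[OF KH compactin_imp_biequicontinuous[OF S K]] by blast
    \<comment> \<open>The left factor is the identity: a right translation suffices.\<close>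
    have "two_sided_translate (HomeoGroup ?S) \<one>\<^bsub>HomeoGroup ?S\<^esub> K h = (\<lambda>k. compose ?S k h) ` K"
      unfolding two_sided_translate_def
    proof (rule image_cong[OF refl])
      fix k assume "k \<in> K"
      then have "k \<in> Homeo ?S" using KH by blast
      then show "\<one>\<^bsub>HomeoGroup ?S\<^esub> \<otimes>\<^bsub>HomeoGroup ?S\<^esub> k \<otimes>\<^bsub>HomeoGroup ?S\<^esub> h = compose ?S k h"
        using G.l_one[of k] h(1) by (simp add: mult_HomeoGroup)
    qed
    with h(2) have "two_sided_translate (HomeoGroup ?S) \<one>\<^bsub>HomeoGroup ?S\<^esub> K h \<subseteq> F" by (simp only:)
    moreover have "h \<in> carrier (HomeoGroup ?S)" using h(1) by simp
    ultimately show "\<exists>g\<in>carrier (HomeoGroup ?S). \<exists>h\<in>carrier (HomeoGroup ?S).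
        two_sided_translate (HomeoGroup ?S) g K h \<subseteq> F"
      using G.one_closed by (intro bexI)
  qed
  moreover have "\<not> haar_null (HomeoGroup ?S) (Homeo_topology ?S) F"
    by (rule not_haar_nullI[OF S catch])
  ultimately show ?thesis ..
qed

end
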